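(* Suppose $f \colon \mathbb{N} \to [0,\infty)$ is a sub-identical order function and $h,\hat{h}\colon \mathbb{N} \to [0,\infty)$ are order functions such that $\sum_{n=0}^\infty 2^{-h(n)} < \infty$, $\sum_{n=0}^\infty 2^{-\hat{h}(n)} < \infty$, and $\lim_{n \to \infty}(h(n) - \hat{h}(n)) = \infty$. Then $$\mathrm{LUA}\bigl(\lambda n.\, \exp_2\bigl(f^{\mathrm{inv}}(h(n))+1\bigr)\bigr) \leq_{\mathrm{s}} \mathrm{COMPLEX}(f).$$
   Context: $\exp_2(x)=2^x$. An order function is a computable (i.e. its values are uniformly computable reals), nondecreasing, unbounded function $\mathbb{N}\to\mathbb{R}$. A function $f\colon\mathbb{N}\to[0,\infty)$ is sub-identical if $\lim_{n\to\infty}(n-f(n))=\infty$. For nondecreasing unbounded $f\colon\mathbb{N}\to\mathbb{R}$, $f^{\mathrm{inv}}\colon\mathbb{R}\to\mathbb{N}$ is defined by $f^{\mathrm{inv}}(x)=$ the least $m\in\mathbb{N}$ with $f(m)\geq x$. Prefix-free complexity: a prefix-free machine is a partial recursive $M$ from $\{0,1\}^*$ to $\{0,1\}^*$ with prefix-free domain; $U$ is universal if for each prefix-free machine $M$ there is $\rho$ with $U(\rho^\frown\tau)\simeq M(\tau)$ for all $\tau$. Fix a universal $U$ and let $K(\sigma)=\min\{|\tau| : U(\tau)=\sigma\}$. For $f\colon\mathbb{N}\to\mathbb{R}$, $\mathrm{COMPLEX}(f)$ is the set of $X\in\{0,1\}^{\mathbb{N}}$ for which there is $c\in\mathbb{N}$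 with $K(X\upharpoonright n)\geq f(n)-c$ for all $n$. A partial recursive $\psi\colon\subseteq\mathbb{N}\to\mathbb{N}$ is linearly universal if for every partial recursive $\theta\colon\subseteq\mathbb{N}\to\mathbb{N}$ there are $a,b\in\mathbb{N}$ with $\psi(ax+b)\simeq\theta(x)$ for all $x$. For $p\colon\mathbb{N}\to(1,\infty)$, $\mathrm{LUA}(p)$ is the set of $X\in\mathbb{N}^{\mathbb{N}}$ such that $X(n)<p(n)$ for all $n$ and, for some linearly universal partial recursive $\psi$, there is no $n\in\operatorname{dom}\psi$ with $X(n)=\psi(n)$. For $P,Q\subseteq\mathbb{N}^{\mathbb{N}}$, $P\leq_{\mathrm{s}}Q$ means there is a partial recursive functional defined on all of $Q$ that maps $Q$ into $P$. *)

theory Defs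
  imports Complex_Main "HOL-Library.Sublist"
begin

text \<open>Kleene's schemes of recursive functions, extended by an oracle. Programs take a list of
  arguments; a program applied to an argument list of the wrong length may simply diverge.\<close>

datatype recf =
    Zero
  | Succ
  | Proj nat
  | Oracle
  | Comp recf "recf list"
  | PrimRec recf recf
  | Mu recf

text \<open>\<open>rec_eval X e xs y\<close>: program \<open>e\<close> with oracle \<open>X\<close> halts on input \<open>xs\<close> with output \<open>y\<close>.\<close>

inductive rec_eval :: "(nat \<Rightarrow> nat) \<Rightarrow> recf \<Rightarrow> nat list \<Rightarrow> nat \<Rightarrow> bool" for X where
  Zero: "rec_eval X Zero xs 0"
| Succ: "rec_eval X Succ [x] (Suc x)"
| Proj: "i < length xs \<Longrightarrow> rec_eval X (Proj i) xs (xs ! i)"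
| Oracle: "rec_eval X Oracle [x] (X x)"
| Comp: "\<lbrakk>length ys = length gs; \<forall>i<length gs. rec_eval X (gs ! i) xs (ys ! i); rec_eval X f ys z\<rbrakk>
    \<Longrightarrow> rec_eval X (Comp f gs) xs z"
| PrimRec_0: "rec_eval X f xs y \<Longrightarrow> rec_eval X (PrimRec f g) (0 # xs) y"
| PrimRec_Suc: "\<lbrakk>rec_eval X (PrimRec f g) (n # xs) r; rec_eval X g (n # r # xs) y\<rbrakk>
    \<Longrightarrow> rec_eval X (PrimRec f g) (Suc n # xs) y"
| Mu: "\<lbrakk>rec_eval X f (n # xs) 0; \<forall>m<n. \<exists>k. rec_eval X f (m # xs) (Suc k)\<rbrakk>
    \<Longrightarrow> rec_eval X (Mu f) xs n"

inductive_cases rec_eval_ZeroE: "rec_eval X Zero xs y"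
inductive_cases rec_eval_SuccE: "rec_eval X Succ xs y"
inductive_cases rec_eval_ProjE: "rec_eval X (Proj i) xs y"
inductive_cases rec_eval_OracleE: "rec_eval X Oracle xs y"
inductive_cases rec_eval_CompE: "rec_eval X (Comp f gs) xs y"
inductive_cases rec_eval_PrimRec_0E: "rec_eval X (PrimRec f g) (0 # xs) y"
inductive_cases rec_eval_PrimRec_SucE: "rec_eval X (PrimRec f g) (Suc n # xs) y"
inductive_cases rec_eval_MuE: "rec_eval X (Mu f) xs y"

lemma rec_eval_functional: "rec_eval X e xs y \<Longrightarrow> rec_eval X e xs z \<Longrightarrow> y = z"
proof (induction arbitrary: z rule: rec_eval.induct)
  case (Zero xs)
  then show ?case by (rule rec_eval_ZeroE) simp
next
  case (Succ x)
  then show ?case by (rule rec_eval_SuccE) simp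
next
  case (Proj i xs)
  from Proj.prems show ?case by (rule rec_eval_ProjE) simp
next
  case (Oracle x)
  then show ?case by (rule rec_eval_OracleE) simp
next
  case (PrimRec_0 f xs y g)
  from PrimRec_0.prems show ?case
    by (rule rec_eval_PrimRec_0E) (rule PrimRec_0.IH)
next
  case (Comp ys gs xs f y)
  from Comp.prems obtain ys' where ys': "length ys' = length gs"
    "\<forall>i<length gs. rec_eval X (gs ! i) xs (ys' ! i)" "rec_eval X f ys' z"
    by (rule rec_eval_CompE)
  have "ys = ys'"
    using Comp.hyps Comp.IH(1) ys' by (intro nth_equalityI) auto
  with ys' Comp.IH(2) show ?case by blast
next
  case (PrimRec_Suc f g n xs r y)
  from PrimRec_Suc.prems show ?case
    by (rule rec_eval_PrimRec_SucE) (use PrimRec_Suc.IH in blast)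
next
  case (Mu f n xs)
  from Mu.prems have z: "rec_eval X f (z # xs) 0" "\<forall>m<z. \<exists>k. rec_eval X f (m # xs) (Suc k)"
    by (auto elim: rec_eval_MuE)
  show ?case
  proof (rule linorder_cases[of n z])
    assume "n < z"
    with z(2) Mu.IH(1) show ?thesis by fastforce
  next
    assume "z < n"
    with z(1) Mu.IH(2) show ?thesis by fastforce
  qed
qed

fun oracle_free :: "recf \<Rightarrow> bool" where
  "oracle_free Oracle \<longleftrightarrow> False"
| "oracle_free (Comp f gs) \<longleftrightarrow> oracle_free f \<and> (\<forall>g\<in>set gs. oracle_free g)"
| "oracle_free (PrimRec f g) \<longleftrightarrow> oracle_free f \<and> oracle_free g"
| "oracle_free (Mu f) \<longleftrightarrow> oracle_free f"
| "oracle_free _ \<longleftrightarrow> True"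

lemma oracle_free_rec_eval:
  "rec_eval X e xs y \<Longrightarrow> oracle_free e \<Longrightarrow> rec_eval Y e xs y"
proof (induction rule: rec_eval.induct)
  case (Mu f n xs)
  then show ?case by (auto intro!: rec_eval.Mu)
qed (auto intro: rec_eval.intros)

text \<open>By the previous lemma the oracle \<open>\<lambda>_. 0\<close> below is a dummy.\<close>

definition partial_recursive :: "(nat \<rightharpoonup> nat) \<Rightarrow> bool" where
  "partial_recursive \<psi> \<longleftrightarrow>
    (\<exists>e. oracle_free e \<and> (\<forall>x y. \<psi> x = Some y \<longleftrightarrow> rec_eval (\<lambda>_. 0) e [x] y))"

definition recursive2 :: "(nat \<Rightarrow> nat \<Rightarrow> nat) \<Rightarrow> bool" where
  "recursive2 g \<longleftrightarrow> (\<exists>e. oracle_free e \<and> (\<forall>x y. rec_eval (\<lambda>_. 0) e [x, y] (g x y)))"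

text \<open>The domain of the functional given by \<open>e\<close> consists of those \<open>X\<close> for which
  \<open>e\<close> with oracle \<open>X\<close> computes a total function.\<close>

definition partial_recursive_functional :: "((nat \<Rightarrow> nat) \<rightharpoonup> (nat \<Rightarrow> nat)) \<Rightarrow> bool" where
  "partial_recursive_functional \<Psi> \<longleftrightarrow>
    (\<exists>e. \<forall>X Y. \<Psi> X = Some Y \<longleftrightarrow> (\<forall>n. rec_eval X e [n] (Y n)))"

definition strongly_reducible :: "(nat \<Rightarrow> nat) set \<Rightarrow> (nat \<Rightarrow> nat) set \<Rightarrow> bool"
    (infix "\<le>\<^sub>s" 50) where
  "P \<le>\<^sub>s Q \<longleftrightarrow>
    (\<exists>\<Psi>. partial_recursive_functional \<Psi> \<and> Q \<subseteq> dom \<Psi> \<and> (\<forall>X\<in>Q. the (\<Psi> X) \<in> P))"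


text \<open>The rational \<open>2\<^sup>-\<^sup>k\<close>-approximations are presented by recursive functions for the positive
  and the negative part of the numerator and for the predecessor of the denominator.\<close>

definition computable_real_seq :: "(nat \<Rightarrow> real) \<Rightarrow> bool" where
  "computable_real_seq f \<longleftrightarrow>
    (\<exists>a b d. recursive2 a \<and> recursive2 b \<and> recursive2 d \<and>
      (\<forall>n k. \<bar>f n - (real (a n k) - real (b n k)) / real (Suc (d n k))\<bar> \<le> 1 / 2 ^ k))"

definition order_function :: "(nat \<Rightarrow> real) \<Rightarrow> bool" where
  "order_function f \<longleftrightarrow> computable_real_seq f \<and> mono f \<and> \<not> bdd_above (range f)"

definition sub_identical :: "(nat \<Rightarrow> real) \<Rightarrow> bool" where
  "sub_identical f \<longleftrightarrow> (\<forall>n. 0 \<le> f n) \<and> filterlim (\<lambda>n. real n - f n) at_top sequentially"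

definition f_inv :: "(nat \<Rightarrow> real) \<Rightarrow> real \<Rightarrow> nat" where
  "f_inv f x = (LEAST m. f m \<ge> x)"


text \<open>Binary strings are identified with natural numbers by bijective base-2 notation
  (least significant digit first, digits 1 and 2).\<close>

fun str_code :: "bool list \<Rightarrow> nat" where
  "str_code [] = 0"
| "str_code (b # \<sigma>) = 2 * str_code \<sigma> + (if b then 2 else 1)"

lemma bij_str_code: "bij str_code"
proof (rule bijI)
  show "inj str_code"
  proof (rule injI)
    fix \<sigma> \<tau> show "str_code \<sigma> = str_code \<tau> \<Longrightarrow> \<sigma> = \<tau>"
    proof (induction \<sigma> arbitrary: \<tau>)
      case Nil
      then show ?case by (cases \<tau>) (auto split: if_splits)
    next
      case (Cons b \<sigma>)
      show ?case
      proof (cases \<tau>)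
        case Nil
        with Cons.prems show ?thesis by (auto split: if_splits)
      next
        case (Cons c \<tau>')
        with Cons.prems have "b = c \<and> str_code \<sigma> = str_code \<tau>'"
          by (cases b; cases c; simp; presburger)
        with Cons Cons.IH show ?thesis by blast
      qed
    qed
  qed
  have "\<exists>\<sigma>. str_code \<sigma> = n" for n
  proof (induction n rule: less_induct)
    case (less n)
    show ?case
    proof (cases "n = 0")
      case True
      then show ?thesis by (intro exI[of _ "[]"]) simp
    next
      case False
      then have "(n - 1) div 2 < n" by linarith
      with less obtain \<sigma> where \<sigma>: "str_code \<sigma> = (n - 1) div 2" by blast
      have "2 * ((n - 1) div 2) + (if even n then 2 else 1) = n"
        using False by (cases "even n") (auto elim!: evenE oddE)
      with \<sigma> have "str_code (even n # \<sigma>) = n" by simp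
      then show ?thesis by blast
    qed
  qed
  then show "surj str_code" by (metis surjI)
qed

definition partial_recursive_str :: "(bool list \<rightharpoonup> bool list) \<Rightarrow> bool" where
  "partial_recursive_str M \<longleftrightarrow>
    (\<exists>\<psi>. partial_recursive \<psi> \<and> (\<forall>\<sigma>. \<psi> (str_code \<sigma>) = map_option str_code (M \<sigma>)))"

definition prefix_free_machine :: "(bool list \<rightharpoonup> bool list) \<Rightarrow> bool" where
  "prefix_free_machine M \<longleftrightarrow>
    partial_recursive_str M \<and> (\<forall>\<sigma>\<in>dom M. \<forall>\<tau>\<in>dom M. prefix \<sigma> \<tau> \<longrightarrow> \<sigma> = \<tau>)"

definition universal_prefix_free_machine :: "(bool list \<rightharpoonup> bool list) \<Rightarrow> bool" where
  "universal_prefix_free_machine U \<longleftrightarrow>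
    prefix_free_machine U \<and>
    (\<forall>M. prefix_free_machine M \<longrightarrow> (\<exists>\<rho>. \<forall>\<tau>. U (\<rho> @ \<tau>) = M \<tau>))"

definition prefix_free_K :: "(bool list \<rightharpoonup> bool list) \<Rightarrow> bool list \<Rightarrow> nat" where
  "prefix_free_K U \<sigma> = (LEAST l. \<exists>\<tau>. length \<tau> = l \<and> U \<tau> = Some \<sigma>)"

text \<open>Elements of Cantor space are the sequences of natural numbers with values in \<open>{0, 1}\<close>.\<close>

definition initial_segment :: "(nat \<Rightarrow> nat) \<Rightarrow> nat \<Rightarrow> bool list" where
  "initial_segment X n = map (\<lambda>i. X i = 1) [0..<n]"

definition COMPLEX :: "(bool list \<rightharpoonup> bool list) \<Rightarrow> (nat \<Rightarrow> real) \<Rightarrow> (nat \<Rightarrow> nat) set" where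
  "COMPLEX U f = {X. (\<forall>n. X n \<in> {0, 1}) \<and>
    (\<exists>c::nat. \<forall>n. real (prefix_free_K U (initial_segment X n)) \<ge> f n - real c)}"


definition linearly_universal :: "(nat \<rightharpoonup> nat) \<Rightarrow> bool" where
  "linearly_universal \<psi> \<longleftrightarrow>
    partial_recursive \<psi> \<and>
    (\<forall>\<theta>. partial_recursive \<theta> \<longrightarrow> (\<exists>a b. \<forall>x. \<psi> (a * x + b) = \<theta> x))"

definition LUA :: "(nat \<Rightarrow> real) \<Rightarrow> (nat \<Rightarrow> nat) set" where
  "LUA p = {X. (\<forall>n. real (X n) < p n) \<and>
    (\<exists>\<psi>. linearly_universal \<psi> \<and> \<not> (\<exists>n\<in>dom \<psi>. \<psi> n = Some (X n)))}"

end

theory Submission imports Defs begin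

text \<open>Let \<open>X\<close> be in \<open>COMPLEX U f\<close>. Output the code of \<open>X\<close> restricted to \<open>g n\<close>, where \<open>g\<close> is a
  recursive function with \<open>g n \<le> f_inv f (h n)\<close> and \<open>f (g n) \<ge> h n - 1\<close>. This string has complexity
  at least \<open>h n - O(1)\<close>. On the other hand, \<open>h'\<close> being summable, the Kraft--Chaitin construction
  shows that the string coded by \<open>\<phi> n\<close> has complexity at most \<open>h' n + O(1)\<close> for every partial
  recursive \<open>\<phi>\<close>. As \<open>h - h'\<close> tends to infinity, the output avoids \<open>\<phi>\<close> from some point \<open>N\<close> on, and
  a suitable linearly universal \<open>\<phi>\<close> remains so when its domain is restricted to \<open>{N..}\<close>.\<close>

section \<open>Closure properties of recursive functions\<close>

text \<open>One program serves all oracles \<open>X\<close>; it may query the oracle only if \<open>orc\<close> holds.\<close>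

definition rec_total :: "bool \<Rightarrow> nat \<Rightarrow> ((nat \<Rightarrow> nat) \<Rightarrow> nat list \<Rightarrow> nat) \<Rightarrow> bool" where
  "rec_total orc k F \<longleftrightarrow>
    (\<exists>e. (orc \<or> oracle_free e) \<and> (\<forall>X xs. length xs = k \<longrightarrow> rec_eval X e xs (F X xs)))"

lemma rec_totalI:
  assumes "orc \<or> oracle_free e" and "\<And>X xs. length xs = k \<Longrightarrow> rec_eval X e xs (F X xs)"
  shows "rec_total orc k F"
  using assms unfolding rec_total_def by blast

lemma rec_totalE:
  assumes "rec_total orc k F"
  obtains e where "orc \<or> oracle_free e" and "\<And>X xs. length xs = k \<Longrightarrow> rec_eval X e xs (F X xs)"
  using assms unfolding rec_total_def by blast

lemma rec_total_nth: "i < k \<Longrightarrow> rec_total orc k (\<lambda>X xs. xs ! i)"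
  by (rule rec_totalI[where e = "Proj i"]) (auto intro: rec_eval.Proj)

text \<open>\<open>rec_total_Least\<close> presents the parameters as the tail of the argument list,
  and \<open>rec_total_rec_nat\<close> as what is left after dropping two entries. This rule and the
  next discharge those forms.\<close>

lemma rec_total_tl_nth: "Suc i < k \<Longrightarrow> rec_total orc k (\<lambda>X xs. tl xs ! i)"
  by (rule rec_totalI[where e = "Proj (Suc i)"]) (auto simp: nth_tl intro: rec_eval.Proj)

lemma rec_total_drop_nth: "j + i < k \<Longrightarrow> rec_total orc k (\<lambda>X xs. drop j xs ! i)"
  by (rule rec_totalI[where e = "Proj (j + i)"]) (auto intro: rec_eval.Proj)

text \<open>The outer function may depend on the oracle, so the case
  \<open>g = (\<lambda>X. X)\<close> covers oracle queries.\<close>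

lemma rec_total_comp1:
  assumes "rec_total orc 1 (\<lambda>X xs. g X (xs ! 0))" and "rec_total orc k A"
  shows "rec_total orc k (\<lambda>X xs. g X (A X xs))"
proof -
  obtain e where e: "orc \<or> oracle_free e"
    "\<And>X xs. length xs = 1 \<Longrightarrow> rec_eval X e xs (g X (xs ! 0))"
    using assms(1) by (rule rec_totalE) blast
  obtain a where a: "orc \<or> oracle_free a" "\<And>X xs. length xs = k \<Longrightarrow> rec_eval X a xs (A X xs)"
    using assms(2) by (rule rec_totalE) blast
  show ?thesis
  proof (rule rec_totalI[where e = "Comp e [a]"])
    fix X and xs :: "nat list"
    assume "length xs = k"
    then show "rec_eval X (Comp e [a]) xs (g X (A X xs))"
      using a(2) e(2)[of "[A X xs]" X] by (intro rec_eval.Comp[where ys = "[A X xs]"]) auto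
  qed (use e(1) a(1) in auto)
qed

lemma rec_total_comp2:
  assumes "rec_total orc 2 (\<lambda>X xs. g X (xs ! 0) (xs ! 1))" and "rec_total orc k A"
    and "rec_total orc k B"
  shows "rec_total orc k (\<lambda>X xs. g X (A X xs) (B X xs))"
proof -
  obtain e where e: "orc \<or> oracle_free e"
    "\<And>X xs. length xs = 2 \<Longrightarrow> rec_eval X e xs (g X (xs ! 0) (xs ! 1))"
    using assms(1) by (rule rec_totalE) blast
  obtain a where a: "orc \<or> oracle_free a" "\<And>X xs. length xs = k \<Longrightarrow> rec_eval X a xs (A X xs)"
    using assms(2) by (rule rec_totalE) blast
  obtain b where b: "orc \<or> oracle_free b" "\<And>X xs. length xs = k \<Longrightarrow> rec_eval X b xs (B X xs)"
    using assms(3) by (rule rec_totalE) blast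
  show ?thesis
  proof (rule rec_totalI[where e = "Comp e [a, b]"])
    fix X and xs :: "nat list"
    assume "length xs = k"
    then show "rec_eval X (Comp e [a, b]) xs (g X (A X xs) (B X xs))"
      using a(2) b(2) e(2)[of "[A X xs, B X xs]" X]
      by (intro rec_eval.Comp[where ys = "[A X xs, B X xs]"]) (auto simp: less_Suc_eq)
  qed (use e(1) a(1) b(1) in auto)
qed

lemma rec_total_Suc: "rec_total orc k A \<Longrightarrow> rec_total orc k (\<lambda>X xs. Suc (A X xs))"
  by (rule rec_total_comp1[where g = "\<lambda>X. Suc"], rule rec_totalI[where e = Succ])
    (auto simp: length_Suc_conv intro: rec_eval.Succ)

lemma rec_total_oracle: "rec_total True k A \<Longrightarrow> rec_total True k (\<lambda>X xs. X (A X xs))"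
  by (rule rec_total_comp1[where g = "\<lambda>X. X"], rule rec_totalI[where e = Oracle])
    (auto simp: length_Suc_conv intro: rec_eval.Oracle)

lemma rec_total_const: "rec_total orc k (\<lambda>X xs. c)"
proof (induction c)
  case 0
  show ?case by (rule rec_totalI[where e = Zero]) (auto intro: rec_eval.Zero)
qed (rule rec_total_Suc)

lemma rec_total_recursive2:
  assumes "recursive2 g" and "rec_total orc k A" and "rec_total orc k B"
  shows "rec_total orc k (\<lambda>X xs. g (A X xs) (B X xs))"
proof (rule rec_total_comp2[where g = "\<lambda>X. g"])
  obtain e where e: "oracle_free e" "\<And>x y. rec_eval (\<lambda>_. 0) e [x, y] (g x y)"
    using assms(1) unfolding recursive2_def by blast
  show "rec_total orc 2 (\<lambda>X xs. g (xs ! 0) (xs ! 1))"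
    using e oracle_free_rec_eval[OF e(2) e(1)]
    by (intro rec_totalI[where e = e]) (auto simp: length_Suc_conv numeral_2_eq_2)
qed (use assms in auto)

lemma rec_total_rec_nat:
  assumes "rec_total orc k F"
    and "rec_total orc (Suc (Suc k)) (\<lambda>X ys. G X (ys ! 0) (ys ! 1) (drop 2 ys))"
    and "rec_total orc k N"
  shows "rec_total orc k (\<lambda>X xs. rec_nat (F X xs) (\<lambda>n r. G X n r xs) (N X xs))"
proof -
  obtain f where f: "orc \<or> oracle_free f" "\<And>X xs. length xs = k \<Longrightarrow> rec_eval X f xs (F X xs)"
    using assms(1) by (rule rec_totalE) blast
  obtain g where g: "orc \<or> oracle_free g" "\<And>X ys. length ys = Suc (Suc k) \<Longrightarrow>
      rec_eval X g ys (G X (ys ! 0) (ys ! 1) (drop 2 ys))"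
    using assms(2) by (rule rec_totalE) blast
  obtain a where a: "orc \<or> oracle_free a" "\<And>X xs. length xs = k \<Longrightarrow> rec_eval X a xs (N X xs)"
    using assms(3) by (rule rec_totalE) blast
  \<comment> \<open>\<open>PrimRec\<close> recurses on its first argument, so the recursion bound is
    computed first and the \<open>k\<close> parameters are copied behind it.\<close>
  let ?e = "Comp (PrimRec f g) (a # map Proj [0..<k])"
  show ?thesis
  proof (rule rec_totalI[where e = ?e])
    fix X and xs :: "nat list"
    assume xs: "length xs = k"
    have rec: "rec_eval X (PrimRec f g) (n # xs) (rec_nat (F X xs) (\<lambda>n r. G X n r xs) n)" for n
    proof (induction n)
      case 0
      then show ?case using f(2) xs by (auto intro: rec_eval.PrimRec_0)
    next
      case (Suc n)
      let ?r = "rec_nat (F X xs) (\<lambda>n r. G X n r xs) n"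
      show ?case using Suc g(2)[of "n # ?r # xs" X] xs
        by (auto intro: rec_eval.PrimRec_Suc)
    qed
    have "rec_eval X ((a # map Proj [0..<k]) ! i) xs ((N X xs # xs) ! i)"
      if "i < Suc k" for i
      using that a(2) xs by (cases i) (auto intro: rec_eval.Proj)
    then show "rec_eval X ?e xs (rec_nat (F X xs) (\<lambda>n r. G X n r xs) (N X xs))"
      using rec xs by (intro rec_eval.Comp[where ys = "N X xs # xs"]) auto
  qed (use f(1) g(1) a(1) in auto)
qed

lemma rec_eval_Mu_Least:
  assumes "\<And>n. rec_eval X f (n # xs) (F n)" and "\<exists>n. F n = 0"
  shows "rec_eval X (Mu f) xs (LEAST n. F n = 0)"
proof (rule rec_eval.Mu)
  have "F (LEAST n. F n = 0) = 0" using assms(2) by (rule LeastI_ex)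
  then show "rec_eval X f ((LEAST n. F n = 0) # xs) 0"
    using assms(1)[of "LEAST n. F n = 0"] by simp
  show "\<forall>m<(LEAST n. F n = 0). \<exists>k. rec_eval X f (m # xs) (Suc k)"
  proof (intro allI impI)
    fix m assume "m < (LEAST n. F n = 0)"
    then have "F m \<noteq> 0" by (rule not_less_Least)
    then show "\<exists>k. rec_eval X f (m # xs) (Suc k)"
      using assms(1)[of m] by (metis not0_implies_Suc)
  qed
qed

lemma rec_total_Least:
  assumes "rec_total orc (Suc k) (\<lambda>X ys. F X (ys ! 0) (tl ys))"
    and ex: "\<And>X xs. length xs = k \<Longrightarrow> \<exists>n. F X n xs = 0"
  shows "rec_total orc k (\<lambda>X xs. LEAST n. F X n xs = 0)"
proof -
  obtain f where f: "orc \<or> oracle_free f" "\<And>X ys. length ys = Suc k \<Longrightarrow>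
      rec_eval X f ys (F X (ys ! 0) (tl ys))"
    using assms(1) by (rule rec_totalE) blast
  show ?thesis
  proof (rule rec_totalI[where e = "Mu f"])
    fix X and xs :: "nat list"
    assume xs: "length xs = k"
    have "rec_eval X f (n # xs) (F X n xs)" for n
      using f(2)[of "n # xs" X] xs by simp
    then show "rec_eval X (Mu f) xs (LEAST n. F X n xs = 0)"
      using ex[OF xs] by (rule rec_eval_Mu_Least)
  qed (use f(1) in simp)
qed

section \<open>Arithmetic functions\<close>

lemma rec_total_add:
  assumes "rec_total orc k A" and "rec_total orc k B"
  shows "rec_total orc k (\<lambda>X xs. A X xs + B X xs)"
proof -
  have "x + y = rec_nat x (\<lambda>n r. Suc r) y" for x y :: nat by (induction y) auto
  then show ?thesis
    by simp (intro rec_total_rec_nat rec_total_Suc rec_total_nth assms; simp)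
qed

lemma rec_total_mult:
  assumes "rec_total orc k A" and "rec_total orc k B"
  shows "rec_total orc k (\<lambda>X xs. A X xs * B X xs)"
\<comment> \<open>The step function below refers to the parameter \<open>x\<close>. Passing to the
  two projections first makes \<open>x\<close> an entry of the argument list rather than the value
  of an arbitrary \<open>A\<close>.\<close>
proof (rule rec_total_comp2[where g = "\<lambda>X x y. x * y", OF _ assms])
  have "x * y = rec_nat 0 (\<lambda>n r. r + x) y" for x y :: nat by (induction y) auto
  then show "rec_total orc 2 (\<lambda>X xs. xs ! 0 * xs ! 1)"
    by (simp only:) (intro rec_total_rec_nat rec_total_const rec_total_add rec_total_nth
      rec_total_drop_nth; simp)
qed

lemma rec_total_power:
  assumes "rec_total orc k A" and "rec_total orc k B"
  shows "rec_total orc k (\<lambda>X xs. A X xs ^ B X xs)"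
proof (rule rec_total_comp2[where g = "\<lambda>X x y. x ^ y", OF _ assms])
  have "x ^ y = rec_nat 1 (\<lambda>n r. r * x) y" for x y :: nat by (induction y) auto
  then show "rec_total orc 2 (\<lambda>X xs. xs ! 0 ^ xs ! 1)"
    by (simp only:) (intro rec_total_rec_nat rec_total_const rec_total_mult rec_total_nth
      rec_total_drop_nth; simp)
qed

lemma rec_total_pred:
  assumes "rec_total orc k A"
  shows "rec_total orc k (\<lambda>X xs. A X xs - 1)"
proof -
  have "x - 1 = rec_nat 0 (\<lambda>n r. n) x" for x :: nat by (cases x) auto
  then show ?thesis
    by (simp only:) (intro rec_total_rec_nat rec_total_const rec_total_nth assms; simp)
qed

lemma rec_total_diff:
  assumes "rec_total orc k A" and "rec_total orc k B"
  shows "rec_total orc k (\<lambda>X xs. A X xs - B X xs)"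
proof -
  have eq: "rec_nat x (\<lambda>n r. r - 1) y = x - y" for x y :: nat by (induction y) auto
  have "rec_total orc k (\<lambda>X xs. rec_nat (A X xs) (\<lambda>n r. r - 1) (B X xs))"
    by (intro rec_total_rec_nat rec_total_pred rec_total_nth assms) simp
  then show ?thesis by (simp only: eq)
qed

lemma rec_total_div:
  assumes "rec_total orc k A" and "rec_total orc k B"
  shows "rec_total orc k (\<lambda>X xs. A X xs div B X xs)"
proof (rule rec_total_comp2[where g = "\<lambda>X x y. x div y", OF _ assms])
  \<comment> \<open>With truncated subtraction, this expression vanishes iff
    \<open>x < Suc q * y\<close> or \<open>y = 0\<close>. The outer factor \<open>y\<close> makes
    the search stop at 0 for divisor 0, in agreement with \<open>x div 0 = 0\<close>.\<close>
  have small: "(Suc x - Suc (x div y) * y) * y = 0" for x y :: nat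
    using dividend_less_div_times[of y x] by (cases "y = 0") (auto simp: algebra_simps)
  have ex_small: "\<exists>q. (Suc x - Suc q * y) * y = 0" for x y :: nat using small by blast
  have "x div y = (LEAST q. (Suc x - Suc q * y) * y = 0)" for x y :: nat
  proof (rule Least_equality[symmetric])
    fix q assume q: "(Suc x - Suc q * y) * y = 0"
    show "x div y \<le> q"
    proof (cases "y = 0")
      case False
      with q have "x < Suc q * y" by auto
      then show ?thesis using less_mult_imp_div_less less_Suc_eq_le by blast
    qed simp
  qed (rule small)
  moreover have "rec_total orc 2
      (\<lambda>X xs. LEAST q. (Suc (xs ! 0) - Suc q * xs ! 1) * xs ! 1 = 0)"
  proof (rule rec_total_Least)
    show "rec_total orc (Suc 2)
        (\<lambda>X ys. (Suc (tl ys ! 0) - Suc (ys ! 0) * tl ys ! 1) * tl ys ! 1)"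
      by (intro rec_total_mult rec_total_diff rec_total_Suc rec_total_nth rec_total_tl_nth) auto
  qed (rule ex_small)
  ultimately show "rec_total orc 2 (\<lambda>X xs. xs ! 0 div xs ! 1)" by (simp only:)
qed

lemma rec_total_mod:
  assumes "rec_total orc k A" and "rec_total orc k B"
  shows "rec_total orc k (\<lambda>X xs. A X xs mod B X xs)"
  unfolding minus_div_mult_eq_mod[symmetric]
  by (intro rec_total_diff rec_total_mult rec_total_div assms)

lemmas rec_total_intros = rec_total_nth rec_total_tl_nth rec_total_drop_nth rec_total_const
  rec_total_Suc rec_total_add rec_total_mult rec_total_power rec_total_diff
  rec_total_div rec_total_mod

lemma rec_total_1_comp:
  assumes "rec_total orc 1 (\<lambda>X xs. g (xs ! 0))" and "rec_total orc k A"
  shows "rec_total orc k (\<lambda>X xs. g (A X xs))"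
  using rec_total_comp1[where g = "\<lambda>X. g"] assms by blast

section \<open>Partial recursive functions of one variable\<close>

lemma partial_recursive_total:
  assumes "rec_total False 1 (\<lambda>X xs. g (xs ! 0))"
  shows "partial_recursive (\<lambda>x. Some (g x))"
proof -
  obtain e where e: "oracle_free e" "\<And>X xs. length xs = 1 \<Longrightarrow> rec_eval X e xs (g (xs ! 0))"
    using assms by (rule rec_totalE) blast
  have "rec_eval (\<lambda>_. 0) e [x] (g x)" for x using e(2)[of "[x]"] by simp
  then show ?thesis
    unfolding partial_recursive_def using e(1) rec_eval_functional by (metis option.inject)
qed

lemma partial_recursive_bind:
  assumes "partial_recursive g" and "partial_recursive \<theta>"
  shows "partial_recursive (\<lambda>x. Option.bind (g x) \<theta>)"
proof -
  obtain a where a: "oracle_free a" "\<And>x y. g x = Some y \<longleftrightarrow> rec_eval (\<lambda>_. 0) a [x] y"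
    using assms(1) unfolding partial_recursive_def by blast
  obtain e where e: "oracle_free e" "\<And>x y. \<theta> x = Some y \<longleftrightarrow> rec_eval (\<lambda>_. 0) e [x] y"
    using assms(2) unfolding partial_recursive_def by blast
  have "Option.bind (g x) \<theta> = Some z \<longleftrightarrow> rec_eval (\<lambda>_. 0) (Comp e [a]) [x] z" for x z
  proof
    assume "Option.bind (g x) \<theta> = Some z"
    then obtain y where "g x = Some y" "\<theta> y = Some z" by (auto simp: bind_eq_Some_conv)
    then show "rec_eval (\<lambda>_. 0) (Comp e [a]) [x] z"
      using a(2) e(2) by (intro rec_eval.Comp[where ys = "[y]"]) auto
  next
    assume "rec_eval (\<lambda>_. 0) (Comp e [a]) [x] z"
    then obtain ys where "length ys = 1" "rec_eval (\<lambda>_. 0) a [x] (ys ! 0)"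
      "rec_eval (\<lambda>_. 0) e ys z"
      by (rule rec_eval_CompE) auto
    then show "Option.bind (g x) \<theta> = Some z"
      using a(2) e(2) by (auto simp: bind_eq_Some_conv length_Suc_conv)
  qed
  then show ?thesis
    unfolding partial_recursive_def using a(1) e(1) by (intro exI[of _ "Comp e [a]"]) auto
qed

lemma partial_recursive_comp_total:
  assumes "partial_recursive \<theta>" and "rec_total False 1 (\<lambda>X xs. g (xs ! 0))"
  shows "partial_recursive (\<lambda>x. \<theta> (g x))"
  using partial_recursive_bind[OF partial_recursive_total[OF assms(2)] assms(1)] by simp

lemma partial_recursive_Mu:
  assumes "rec_total False 2 (\<lambda>X xs. F (xs ! 0) (xs ! 1))"
  shows "partial_recursive (\<lambda>x. if \<exists>n. F n x = 0 then Some (LEAST n. F n x = 0) else None)"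
proof -
  obtain f where f: "oracle_free f"
    "\<And>X xs. length xs = 2 \<Longrightarrow> rec_eval X f xs (F (xs ! 0) (xs ! 1))"
    using assms by (rule rec_totalE) blast
  have F: "rec_eval (\<lambda>_. 0) f [n, x] (F n x)" for n x using f(2)[of "[n, x]"] by simp
  have "(if \<exists>n. F n x = 0 then Some (LEAST n. F n x = 0) else None) = Some y \<longleftrightarrow>
      rec_eval (\<lambda>_. 0) (Mu f) [x] y" for x y
  proof (cases "\<exists>n. F n x = 0")
    case True
    then show ?thesis using rec_eval_Mu_Least[OF F True] rec_eval_functional by auto
  next
    case False
    then have "\<not> rec_eval (\<lambda>_. 0) (Mu f) [x] y"
      using F rec_eval_functional by (metis rec_eval_MuE)
    then show ?thesis unfolding if_not_P[OF False] by simp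
  qed
  then show ?thesis
    unfolding partial_recursive_def using f(1) by (intro exI[of _ "Mu f"]) simp
qed

text \<open>An unbounded search for a preimage, which diverges off the range. It serves to cut
  domains down to the range of a recursive injection.\<close>

lemma partial_recursive_inverse:
  assumes "rec_total False 1 (\<lambda>X xs. g (xs ! 0))" and "inj g"
  obtains \<gamma> where "partial_recursive \<gamma>" and "\<And>n. \<gamma> (g n) = Some n"
    and "\<And>x. x \<notin> range g \<Longrightarrow> \<gamma> x = None"
proof -
  \<comment> \<open>The sum of the two truncated differences is the distance of \<open>g n\<close>
    and \<open>x\<close>.\<close>
  define F where "F n x = (g n - x) + (x - g n)" for n x :: nat
  define \<gamma> where "\<gamma> x = (if \<exists>n. F n x = 0 then Some (LEAST n. F n x = 0) else None)" for x
  have F: "F n x = 0 \<longleftrightarrow> g n = x" for n x unfolding F_def by auto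
  have "partial_recursive \<gamma>"
    unfolding \<gamma>_def
  proof (rule partial_recursive_Mu)
    show "rec_total False 2 (\<lambda>X xs. F (xs ! 0) (xs ! 1))"
      unfolding F_def by (intro rec_total_intros rec_total_1_comp[OF assms(1)]) auto
  qed
  moreover have "\<gamma> (g n) = Some n" for n
    unfolding \<gamma>_def F using inj_eq[OF assms(2)] by (auto intro: Least_equality)
  moreover have "\<gamma> x = None" if "x \<notin> range g" for x
    unfolding \<gamma>_def F using that by auto
  ultimately show ?thesis using that by blast
qed

text \<open>The partial inverse of \<open>n + N\<close> halts exactly on \<open>{N..}\<close>;
  following it by the shifted \<open>\<theta>\<close> changes no value there.\<close>

lemma partial_recursive_restrict_atLeast:
  assumes "partial_recursive \<theta>"
  shows "partial_recursive (\<lambda>n. if N \<le> n then \<theta> n else None)"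
proof -
  obtain \<gamma> where \<gamma>: "partial_recursive \<gamma>" "\<And>n. \<gamma> (n + N) = Some n"
    "\<And>x. x \<notin> range (\<lambda>n. n + N) \<Longrightarrow> \<gamma> x = None"
    by (rule partial_recursive_inverse[of "\<lambda>n. n + N"]) (auto intro!: rec_total_intros)
  have "partial_recursive (\<lambda>n. Option.bind (\<gamma> n) (\<lambda>n. \<theta> (n + N)))"
    by (rule partial_recursive_bind[OF \<gamma>(1) partial_recursive_comp_total[OF assms]])
      (intro rec_total_intros; simp)
  moreover have "Option.bind (\<gamma> n) (\<lambda>n. \<theta> (n + N)) = (if N \<le> n then \<theta> n else None)" for n
  proof (cases "N \<le> n")
    case True
    then show ?thesis using \<gamma>(2)[of "n - N"] by simp
  next
    case False
    then have "n \<notin> range (\<lambda>n. n + N)" by auto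
    then have "\<gamma> n = None" by (rule \<gamma>(3))
    with False show ?thesis by simp
  qed
  ultimately show ?thesis by simp
qed

section \<open>Prefix-free codes and the universal machine\<close>

definition str_decode :: "nat \<Rightarrow> bool list" where
  "str_decode = inv str_code"

lemma str_decode_str_code [simp]: "str_decode (str_code \<sigma>) = \<sigma>"
  unfolding str_decode_def using bij_str_code by (simp add: bij_def)

lemma str_code_str_decode [simp]: "str_code (str_decode n) = n"
  unfolding str_decode_def using bij_str_code by (simp add: bij_def surj_f_inv_f)

lemma map_option_str_code_str_decode: "map_option str_code (map_option str_decode z) = z"
  by (cases z) auto

text \<open>The machine that decodes \<open>t n\<close> to \<open>n\<close> and then runs
  \<open>\<theta>\<close> has its domain inside \<open>range t\<close>, hence is prefix-free, and
  \<open>\<rho>\<close> comes from universality. Unary codes for \<open>t\<close> will give an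
  enumeration of the partial recursive functions, and Kraft--Chaitin codes will give complexity
  bounds.\<close>

lemma universal_prefix_free_machine_simulates:
  assumes U: "universal_prefix_free_machine U" and \<theta>: "partial_recursive \<theta>"
    and rec: "rec_total False 1 (\<lambda>X xs. str_code (t (xs ! 0)))"
    and pf: "\<And>m n. prefix (t m) (t n) \<Longrightarrow> m = n"
  obtains \<rho> where "\<And>n. U (\<rho> @ t n) = map_option str_decode (\<theta> n)"
proof -
  \<comment> \<open>A string is a prefix of itself, so prefix-freeness includes injectivity.\<close>
  have inj: "inj (\<lambda>n. str_code (t n))"
  proof (rule injI)
    fix m n assume "str_code (t m) = str_code (t n)"
    then have "t m = t n" by (metis str_decode_str_code)
    then show "m = n" using pf[of m n] by simp
  qed
  obtain \<gamma> where \<gamma>: "partial_recursive \<gamma>" "\<And>n. \<gamma> (str_code (t n)) = Some n"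
    "\<And>x. x \<notin> range (\<lambda>n. str_code (t n)) \<Longrightarrow> \<gamma> x = None"
    using rec inj by (rule partial_recursive_inverse[of "\<lambda>n. str_code (t n)"]) blast
  define M where "M \<sigma> = map_option str_decode (Option.bind (\<gamma> (str_code \<sigma>)) \<theta>)" for \<sigma>
  have dom: "\<sigma> \<in> range t" if "\<sigma> \<in> dom M" for \<sigma>
  proof -
    have "str_code \<sigma> \<in> range (\<lambda>n. str_code (t n))"
    proof (rule ccontr)
      assume "str_code \<sigma> \<notin> range (\<lambda>n. str_code (t n))"
      then have "\<gamma> (str_code \<sigma>) = None" by (rule \<gamma>(3))
      then have "M \<sigma> = None" unfolding M_def by simp
      with that show False by blast
    qed
    then obtain n where "str_code \<sigma> = str_code (t n)" by blast
    then have "\<sigma> = t n" by (metis str_decode_str_code)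
    then show ?thesis by blast
  qed
  have "partial_recursive_str M"
    unfolding partial_recursive_str_def
  proof (intro exI conjI allI)
    show "partial_recursive (\<lambda>x. Option.bind (\<gamma> x) \<theta>)"
      by (rule partial_recursive_bind[OF \<gamma>(1) \<theta>])
    show "Option.bind (\<gamma> (str_code \<sigma>)) \<theta> = map_option str_code (M \<sigma>)" for \<sigma>
      unfolding M_def by (rule map_option_str_code_str_decode[symmetric])
  qed
  then have "prefix_free_machine M"
    unfolding prefix_free_machine_def using dom pf by blast
  then obtain \<rho> where "\<forall>\<tau>. U (\<rho> @ \<tau>) = M \<tau>"
    using U unfolding universal_prefix_free_machine_def by blast
  then have "U (\<rho> @ t n) = map_option str_decode (\<theta> n)" for n
    unfolding M_def using \<gamma>(2) by simp
  then show ?thesis by (rule that)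
qed

lemma prefix_free_K_le:
  assumes "U \<tau> = Some \<sigma>"
  shows "prefix_free_K U \<sigma> \<le> length \<tau>"
  unfolding prefix_free_K_def using assms by (intro Least_le) blast

section \<open>Codes of strings, their lengths, and unary codes\<close>

lemma str_code_append: "str_code (\<sigma> @ \<tau>) = str_code \<sigma> + 2 ^ length \<sigma> * str_code \<tau>"
  by (induction \<sigma>) (auto simp: algebra_simps)

text \<open>This closed form shows that the unary code is recursive: \<open>x\<close> digits 1
  contribute \<open>2 ^ x - 1\<close>, and the final digit 2 contributes
  \<open>2 * 2 ^ x\<close>.\<close>

lemma str_code_unary: "str_code (replicate x False @ [True]) = 3 * 2 ^ x - 1"
proof -
  have "str_code (replicate x False @ [True]) + 1 = 3 * 2 ^ x" by (induction x) auto
  then show ?thesis by linarith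
qed

lemma prefix_unary:
  assumes "prefix (replicate m False @ [True]) (replicate n False @ [True])"
  shows "m = n"
  using assms
proof (induction m arbitrary: n)
  case 0
  then show ?case by (cases n) auto
next
  case (Suc m)
  show ?case
  proof (cases n)
    case 0
    with Suc.prems show ?thesis by simp
  next
    case (Suc n')
    with Suc.prems have "prefix (replicate m False @ [True]) (replicate n' False @ [True])"
      by simp
    then have "m = n'" by (rule Suc.IH)
    with Suc show ?thesis by simp
  qed
qed

text \<open>The codes of strings of different lengths lie in disjoint intervals, so the length can
  be read off the code. The upper bound is also the source of the summand 1 in the exponent of the
  theorem.\<close>

lemma str_code_bounds: "2 ^ length \<sigma> \<le> Suc (str_code \<sigma>)" "Suc (str_code \<sigma>) < 2 * 2 ^ length \<sigma>"
  by (induction \<sigma>) auto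

lemma length_eq_Least_str_code:
  "length \<sigma> = (LEAST l. Suc (Suc (str_code \<sigma>)) - 2 * 2 ^ l = 0)"
proof (rule Least_equality[symmetric])
  show "Suc (Suc (str_code \<sigma>)) - 2 * 2 ^ length \<sigma> = 0"
    using str_code_bounds(2)[of \<sigma>] by simp
next
  fix l assume "Suc (Suc (str_code \<sigma>)) - 2 * 2 ^ l = 0"
  then have "2 ^ length \<sigma> < (2 :: nat) ^ Suc l" using str_code_bounds(1)[of \<sigma>] by simp
  then have "length \<sigma> < Suc l" by (rule power_less_imp_less_exp[rotated]) simp
  then show "length \<sigma> \<le> l" by simp
qed

lemma rec_total_length_str_decode:
  assumes "rec_total orc k A"
  shows "rec_total orc k (\<lambda>X xs. length (str_decode (A X xs)))"
proof (rule rec_total_1_comp[OF _ assms])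
  have "\<exists>l. Suc (Suc s) - 2 * 2 ^ l = (0 :: nat)" for s
    using str_code_bounds(2)[of "str_decode s"] by (intro exI[of _ "length (str_decode s)"]) simp
  moreover have "length (str_decode s) = (LEAST l. Suc (Suc s) - 2 * 2 ^ l = 0)" for s
    using length_eq_Least_str_code[of "str_decode s"] by simp
  ultimately show "rec_total orc 1 (\<lambda>X xs. length (str_decode (xs ! 0)))"
    by (simp only:) (intro rec_total_Least rec_total_intros; simp)
qed

section \<open>Linearly universal functions\<close>

text \<open>The universal machine itself supplies an enumeration of the partial recursive functions:
  with \<open>s = str_code \<rho>\<close>, the value at \<open>2\<^sup>s (2 x + 1)\<close> is the output of \<open>U\<close> on \<open>\<rho>\<close> followed by
  the unary code of \<open>x\<close>.\<close>

lemma ex_linearly_universal_pos: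
  assumes U: "universal_prefix_free_machine U"
  obtains \<phi> where "partial_recursive \<phi>"
    and "\<And>\<theta>. partial_recursive \<theta> \<Longrightarrow> \<exists>a b. 0 < a \<and> (\<forall>x. \<phi> (a * x + b) = \<theta> x)"
proof -
  have "partial_recursive_str U"
    using U unfolding universal_prefix_free_machine_def prefix_free_machine_def by blast
  then obtain u where u: "partial_recursive u" "\<And>\<sigma>. u (str_code \<sigma>) = map_option str_code (U \<sigma>)"
    unfolding partial_recursive_str_def by blast
  \<comment> \<open>\<open>F s n\<close> is \<open>n\<close> if \<open>2 ^ Suc s\<close> divides
    \<open>n\<close>, and 0 otherwise. Hence \<open>v n\<close> is the exponent of 2 in
    \<open>n\<close>; the factor \<open>n\<close> lets the search stop also for
    \<open>n = 0\<close>.\<close>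
  define F where "F s n = n * (1 - n mod (2 * 2 ^ s))" for s n :: nat
  define v where "v n = (LEAST s. F s n = 0)" for n :: nat
  \<comment> \<open>By \<open>str_code_append\<close> and \<open>str_code_unary\<close>, this is the
    code of \<open>str_decode (v n)\<close> followed by the unary code of the quotient.\<close>
  define g where "g n = v n + 2 ^ length (str_decode (v n)) * (3 * 2 ^ (n div (2 * 2 ^ v n)) - 1)"
    for n
  have ex: "\<exists>s. F s n = 0" for n
  proof
    have "n < 2 * 2 ^ n" using less_exp[of n] by linarith
    then show "F n n = 0" unfolding F_def by (cases "n = 0") auto
  qed
  have v: "rec_total False 1 (\<lambda>X xs. v (xs ! 0))"
    unfolding v_def
  proof (rule rec_total_Least)
    show "rec_total False (Suc 1) (\<lambda>X ys. F (ys ! 0) (tl ys ! 0))"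
      unfolding F_def by (intro rec_total_intros) auto
  qed (rule ex)
  have "rec_total False 1 (\<lambda>X xs. g (xs ! 0))"
    unfolding g_def
    by (intro rec_total_intros rec_total_length_str_decode rec_total_1_comp[OF v]) auto
  then have "partial_recursive (\<lambda>n. u (g n))" by (rule partial_recursive_comp_total[OF u(1)])
  moreover have "\<exists>a b. 0 < a \<and> (\<forall>x. u (g (a * x + b)) = \<theta> x)" if \<theta>: "partial_recursive \<theta>" for \<theta>
  proof -
    let ?t = "\<lambda>x. replicate x False @ [True]"
    have "rec_total False 1 (\<lambda>X xs. str_code (?t (xs ! 0)))"
      unfolding str_code_unary by (intro rec_total_intros) auto
    then obtain \<rho> where \<rho>: "\<And>x. U (\<rho> @ ?t x) = map_option str_decode (\<theta> x)"
      using universal_prefix_free_machine_simulates[OF U \<theta>, of ?t] prefix_unary by blast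
    define s where "s = str_code \<rho>"
    have "u (g (2 * 2 ^ s * x + 2 ^ s)) = \<theta> x" for x
    proof -
      let ?n = "2 * 2 ^ s * x + 2 ^ s"
      have "v ?n = s"
        unfolding v_def
      proof (rule Least_equality)
        show "F s ?n = 0" unfolding F_def by simp
      next
        fix r assume "F r ?n = 0"
        then have r: "?n mod (2 * 2 ^ r) \<noteq> 0" unfolding F_def by (auto simp del: mod_0_imp_dvd)
        show "s \<le> r"
        proof (rule ccontr)
          assume "\<not> s \<le> r"
          then have "2 ^ Suc r dvd (2 :: nat) ^ s" by (intro le_imp_power_dvd) simp
          then have "2 ^ Suc r dvd (2 :: nat) ^ s * (2 * x + 1)" by (rule dvd_mult2)
          then have "2 * 2 ^ r dvd ?n" by (simp add: algebra_simps)
          with r show False by auto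
        qed
      qed
      moreover have "?n div (2 * 2 ^ s) = x" by simp
      ultimately have "g ?n = str_code (\<rho> @ ?t x)"
        unfolding g_def str_code_append[of \<rho>] str_code_unary by (simp add: s_def)
      then show ?thesis using u(2) \<rho> by (simp only: map_option_str_code_str_decode)
    qed
    then show ?thesis by (intro exI[of _ "2 * 2 ^ s"] exI[of _ "2 ^ s"]) simp
  qed
  ultimately show ?thesis by (rule that)
qed

text \<open>Replacing \<open>x\<close> by \<open>x + N\<close> moves the argument to
  \<open>a * x + (a * N + b)\<close>, which is at least \<open>N\<close> because \<open>a\<close> is
  positive.\<close>

lemma linearly_universal_restrict_atLeast:
  assumes \<phi>: "partial_recursive \<phi>"
    and univ: "\<And>\<theta>. partial_recursive \<theta> \<Longrightarrow> \<exists>a b. 0 < a \<and> (\<forall>x. \<phi> (a * x + b) = \<theta> x)"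
  shows "linearly_universal (\<lambda>n. if N \<le> n then \<phi> n else None)"
  unfolding linearly_universal_def
proof (intro conjI allI impI)
  show "partial_recursive (\<lambda>n. if N \<le> n then \<phi> n else None)"
    using \<phi> by (rule partial_recursive_restrict_atLeast)
  fix \<theta> assume "partial_recursive \<theta>"
  \<comment> \<open>Undoes the coming shift; the truncated values for \<open>x < N\<close> are never
    looked up.\<close>
  then have "partial_recursive (\<lambda>x. \<theta> (x - N))"
    by (rule partial_recursive_comp_total) (intro rec_total_intros; simp)
  then obtain a b where ab: "0 < a" "\<And>x. \<phi> (a * x + b) = \<theta> (x - N)" using univ by blast
  have "\<phi> (a * x + (a * N + b)) = \<theta> x" for x
    using ab(2)[of "x + N"] by (simp add: algebra_simps)
  moreover have "N \<le> a * x + (a * N + b)" for x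
    using ab(1) by (simp add: trans_le_add1 trans_le_add2)
  ultimately show "\<exists>a b. \<forall>x. (if N \<le> a * x + b then \<phi> (a * x + b) else None) = \<theta> x"
    by (intro exI[of _ a] exI[of _ "a * N + b"]) simp
qed

section \<open>The Kraft--Chaitin construction for nondecreasing lengths\<close>

text \<open>Most significant digit first, so that strings correspond to dyadic intervals and prefixes
  to inclusions.\<close>

primrec bits :: "nat \<Rightarrow> nat \<Rightarrow> bool list" where
  "bits 0 x = []"
| "bits (Suc l) x = odd (x div 2 ^ l) # bits l x"

lemma length_bits [simp]: "length (bits l x) = l"
  by (induction l) auto

lemma bits_add: "bits (k + j) x = bits k (x div 2 ^ j) @ bits j x"
proof (induction k)
  case (Suc k)
  have "x div 2 ^ (k + j) = x div 2 ^ j div 2 ^ k"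
    by (simp add: power_add mult.commute flip: div_mult2_eq)
  with Suc show ?case by simp
qed simp

lemma bits_eq_imp_mod_eq: "bits l x = bits l y \<Longrightarrow> x mod 2 ^ l = y mod 2 ^ l"
proof (induction l)
  case (Suc l)
  have "x mod 2 ^ Suc l = 2 ^ l * (x div 2 ^ l mod 2) + x mod 2 ^ l" for x :: nat
    unfolding power_Suc2 by (rule mod_mult2_eq)
  with Suc show ?case by (auto simp: mod2_eq_if)
qed simp

text \<open>\<open>bits\<close> adds its newest digit at the front, where \<open>str_code\<close>
  has its least significant digit, so the two recursions run in step. A bit \<open>b\<close> is the
  digit \<open>1 + b\<close>.\<close>

lemma str_code_bits:
  "str_code (bits l x) = rec_nat 0 (\<lambda>i r. 2 * r + 1 + x div 2 ^ i mod 2) l"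
  by (induction l) (auto simp: mod2_eq_if)

lemma rec_total_str_code_bits:
  assumes "rec_total orc k A" and "rec_total orc k B"
  shows "rec_total orc k (\<lambda>X xs. str_code (bits (A X xs) (B X xs)))"
proof (rule rec_total_comp2[where g = "\<lambda>X l x. str_code (bits l x)", OF _ assms])
  show "rec_total orc 2 (\<lambda>X xs. str_code (bits (xs ! 0) (xs ! 1)))"
    unfolding str_code_bits by (intro rec_total_rec_nat rec_total_intros) auto
qed

text \<open>\<open>kraft_num l n / 2 ^ l n\<close> is the partial sum \<open>\<Sum>k<n. 2 powr - l k\<close>.\<close>

primrec kraft_num :: "(nat \<Rightarrow> nat) \<Rightarrow> nat \<Rightarrow> nat" where
  "kraft_num l 0 = 0"
| "kraft_num l (Suc n) = Suc (kraft_num l n) * 2 ^ (l (Suc n) - l n)"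

lemma rec_total_kraft_num:
  assumes "rec_total orc 1 (\<lambda>X xs. l (xs ! 0))" and "rec_total orc k A"
  shows "rec_total orc k (\<lambda>X xs. kraft_num l (A X xs))"
proof -
  have "kraft_num l n = rec_nat 0 (\<lambda>n r. Suc r * 2 ^ (l (Suc n) - l n)) n" for n
    by (induction n) auto
  then show ?thesis
    by (simp only:) (intro rec_total_rec_nat rec_total_1_comp[OF assms(1)] rec_total_intros
      assms(2); simp)
qed

lemma kraft_num_sum:
  assumes "mono l"
  shows "real (kraft_num l n) = 2 ^ l n * (\<Sum>k<n. 1 / 2 ^ l k)"
proof (induction n)
  case (Suc n)
  have "l n \<le> l (Suc n)" using assms by (simp add: monoD)
  then have "(2::real) ^ l (Suc n) = 2 ^ l n * 2 ^ (l (Suc n) - l n)"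
    by (simp flip: power_add)
  with Suc show ?case by (simp add: algebra_simps)
qed simp

text \<open>The \<open>n\<close>-th dyadic interval begins at the sum of the earlier lengths; as the
  sum including its own length is at most 1, it fits into the unit interval.\<close>

lemma kraft_num_less:
  assumes "mono l" and "(\<Sum>k<Suc n. 1 / 2 ^ l k) \<le> (1 :: real)"
  shows "kraft_num l n < 2 ^ l n"
proof -
  have "real (Suc (kraft_num l n)) = 2 ^ l n * (\<Sum>k<Suc n. 1 / 2 ^ l k)"
    using kraft_num_sum[OF assms(1), of n] by (simp add: algebra_simps)
  also have "\<dots> \<le> 2 ^ l n * 1" using assms(2) by (intro mult_left_mono) auto
  finally have "real (Suc (kraft_num l n)) \<le> real (2 ^ l n)" by simp
  then show ?thesis unfolding of_nat_le_iff by simp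
qed

text \<open>Measured in units of \<open>1 / 2 ^ l n\<close>: interval \<open>m\<close> ends no later
  than interval \<open>n\<close> begins. Monotonicity of \<open>l\<close> lets the truncated
  differences of lengths add up.\<close>

lemma kraft_num_mono:
  assumes "mono l" and "m < n"
  shows "Suc (kraft_num l m) * 2 ^ (l n - l m) \<le> kraft_num l n"
  using assms(2)
proof (induction n)
  case (Suc n)
  have mono: "l m \<le> l n" "l n \<le> l (Suc n)" if "m \<le> n"
    using assms(1) that by (auto simp: monoD)
  show ?case
  proof (cases "m = n")
    case False
    with Suc have "m < n" by simp
    with mono have "(2::nat) ^ (l (Suc n) - l m) = 2 ^ (l n - l m) * 2 ^ (l (Suc n) - l n)"
      by (simp flip: power_add)
    then have "Suc (kraft_num l m) * 2 ^ (l (Suc n) - l m) =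
        Suc (kraft_num l m) * 2 ^ (l n - l m) * 2 ^ (l (Suc n) - l n)"
      by (simp only: mult.assoc)
    also have "\<dots> \<le> kraft_num l n * 2 ^ (l (Suc n) - l n)"
      using Suc.IH[OF \<open>m < n\<close>] by (rule mult_le_mono1)
    also have "\<dots> \<le> kraft_num l (Suc n)" by simp
    finally show ?thesis .
  qed simp
qed simp

text \<open>For \<open>m < n\<close>, a prefix would place interval \<open>n\<close> inside interval
  \<open>m\<close>, although it begins only at or after the end of the latter. For
  \<open>n < m\<close>, the string with the larger index is at least as long, so the prefix is an
  equality and the first case applies.\<close>

lemma prefix_bits_kraft_num:
  assumes l: "mono l" and kraft: "\<And>n. (\<Sum>k<n. 1 / 2 ^ l k) \<le> (1 :: real)"
    and pre: "prefix (bits (l m) (kraft_num l m)) (bits (l n) (kraft_num l n))"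
  shows "m = n"
proof -
  have less: False if "m < n" "prefix (bits (l m) (kraft_num l m)) (bits (l n) (kraft_num l n))"
    for m n
  proof -
    define j where "j = l n - l m"
    have ln: "l n = l m + j" using l that(1) unfolding j_def by (simp add: monoD)
    \<comment> \<open>The numerator of the dyadic interval of length \<open>1 / 2 ^ l m\<close> that
      contains interval \<open>n\<close>.\<close>
    let ?q = "kraft_num l n div 2 ^ j"
    have "bits (l m) (kraft_num l m) = bits (l m) ?q"
      using that(2) unfolding ln bits_add by (auto simp: prefix_def append_eq_append_conv)
    then have "kraft_num l m mod 2 ^ l m = ?q mod 2 ^ l m" by (rule bits_eq_imp_mod_eq)
    moreover have "kraft_num l m < 2 ^ l m" by (rule kraft_num_less[OF l kraft])
    moreover have "?q < 2 ^ l m"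
      using kraft_num_less[OF l kraft, of n] unfolding ln power_add
      by (rule less_mult_imp_div_less)
    ultimately have eq: "kraft_num l m = ?q" by simp
    have "Suc (kraft_num l m) * 2 ^ j \<le> kraft_num l n"
      using kraft_num_mono[OF l that(1)] unfolding j_def .
    then have "Suc (kraft_num l m) \<le> ?q" by (simp add: less_eq_div_iff_mult_less_eq)
    with eq show False by simp
  qed
  show ?thesis
  proof (rule linorder_cases[of m n])
    assume nm: "n < m"
    then have "l n \<le> l m" using l by (simp add: monoD)
    obtain zs where zs: "bits (l n) (kraft_num l n) = bits (l m) (kraft_num l m) @ zs"
      using pre unfolding prefix_def by blast
    have "zs = []" using arg_cong[OF zs, of length] \<open>l n \<le> l m\<close> by simp
    with zs have "bits (l m) (kraft_num l m) = bits (l n) (kraft_num l n)" by simp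
    with less[OF nm] show ?thesis by simp
  qed (use less pre in auto)
qed

section \<open>Integer lengths from a summable order function\<close>

lemma rec_total_running_max:
  assumes "rec_total orc 1 (\<lambda>X xs. l (xs ! 0))"
  shows "rec_total orc 1 (\<lambda>X xs. Max (l ` {..xs ! 0}))"
proof -
  \<comment> \<open>With truncated subtraction, \<open>r + (y - r)\<close> is the maximum of
    \<open>r\<close> and \<open>y\<close>.\<close>
  have "Max (l ` {..n}) = rec_nat (l 0) (\<lambda>n r. r + (l (Suc n) - r)) n" for n
  proof (induction n)
    case (Suc n)
    have "Max (l ` {..Suc n}) = max (l (Suc n)) (Max (l ` {..n}))"
      by (simp add: atMost_Suc)
    with Suc show ?case by simp
  qed simp
  then show ?thesis
    by (simp only:) (intro rec_total_rec_nat rec_total_1_comp[OF assms] rec_total_intros; simp)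
qed

lemma computable_real_seq_nat_approx:
  assumes "computable_real_seq h" and "\<And>n. 0 \<le> h n"
  obtains L where "rec_total False 1 (\<lambda>X xs. L (xs ! 0))"
    and "\<And>n. h n - 2 \<le> real (L n)" and "\<And>n. real (L n) \<le> h n + 1"
proof -
  obtain a b d where abd: "recursive2 a" "recursive2 b" "recursive2 d"
    "\<And>n k. \<bar>h n - (real (a n k) - real (b n k)) / real (Suc (d n k))\<bar> \<le> 1 / 2 ^ k"
    using assms(1) unfolding computable_real_seq_def by blast
  \<comment> \<open>Precision \<open>1 / 2 ^ 0\<close> suffices. The truncated numerator replaces
    negative approximations by 0, which is harmless since \<open>h\<close> is nonnegative; rounding
    down costs at most 1 more.\<close>
  define L where "L n = (a n 0 - b n 0) div Suc (d n 0)" for n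
  have "rec_total False 1 (\<lambda>X xs. L (xs ! 0))"
    unfolding L_def by (intro rec_total_intros abd(1-3)[THEN rec_total_recursive2]) auto
  moreover have "h n - 2 \<le> real (L n) \<and> real (L n) \<le> h n + 1" for n
  proof -
    define D where "D = real (Suc (d n 0))"
    define q where "q = (real (a n 0) - real (b n 0)) / D"
    define c where "c = real (a n 0 - b n 0) / D"
    have q: "\<bar>h n - q\<bar> \<le> 1" using abd(4)[of n 0] unfolding q_def D_def by simp
    have "D > 0" unfolding D_def by simp
    then have "c = max q 0"
      unfolding q_def c_def by (auto simp: max_def of_nat_diff field_simps)
    moreover have "real (L n) \<le> c"
      unfolding L_def c_def D_def by (rule of_nat_div_le_of_nat)
    moreover have "c - 1 \<le> real (L n)"
      unfolding L_def c_def D_def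
      using floor_divide_of_nat_eq[where 'a = real, of "a n 0 - b n 0" "Suc (d n 0)"] by linarith
    ultimately show ?thesis using q assms(2)[of n] by linarith
  qed
  ultimately show ?thesis using that by blast
qed

lemma ex_kraft_lengths:
  assumes "computable_real_seq h" and "mono h" and nonneg: "\<And>n. 0 \<le> h n"
    and summ: "summable (\<lambda>n. 2 powr (- h n))"
  obtains l d where "rec_total False 1 (\<lambda>X xs. l (xs ! 0))" and "mono l"
    and "\<And>n. (\<Sum>k<n. 1 / 2 ^ l k) \<le> (1 :: real)" and "\<And>n. real (l n) \<le> h n + real d"
proof -
  obtain L where L: "rec_total False 1 (\<lambda>X xs. L (xs ! 0))"
    "\<And>n. h n - 2 \<le> real (L n)" "\<And>n. real (L n) \<le> h n + 1"
    using computable_real_seq_nat_approx[OF assms(1) nonneg] by blast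
  define S where "S = (\<Sum>n. 2 powr (- h n))"
  \<comment> \<open>The error 2 in the lower bound for \<open>L\<close> costs a factor 4 in the sum,
    and lengthening all strings by \<open>e\<close> divides the sum by \<open>2 ^ e\<close>.\<close>
  obtain e where e: "4 * S < 2 ^ e" using real_arch_pow[of 2 "4 * S"] by auto
  \<comment> \<open>The approximations \<open>L\<close> need not be monotone. Their running maximum
    is, and it still obeys the upper bound because \<open>h\<close> is monotone.\<close>
  define l where "l n = Max (L ` {..n}) + e" for n
  have upper: "real (l n) \<le> h n + real (e + 1)" for n
  proof -
    have "Max (L ` {..n}) \<in> L ` {..n}" by (intro Max_in) auto
    then obtain k where "k \<in> {..n}" "Max (L ` {..n}) = L k" by blast
    then show ?thesis using L(3)[of k] monoD[OF \<open>mono h\<close>, of k n] unfolding l_def by auto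
  qed
  have lower: "h n - 2 + real e \<le> real (l n)" for n
  proof -
    have "L n \<le> Max (L ` {..n})" by (intro Max_ge) auto
    then have "real (L n) \<le> real (Max (L ` {..n}))" by (rule of_nat_mono)
    then show ?thesis using L(2)[of n] unfolding l_def of_nat_add by linarith
  qed
  have "(\<Sum>k<n. 1 / 2 ^ l k) \<le> (1 :: real)" for n
  proof -
    have "1 / 2 ^ l k \<le> 4 / 2 ^ e * 2 powr (- h k)" for k
    proof -
      have "1 / 2 ^ l k = 2 powr (- real (l k))"
        by (simp add: powr_minus powr_realpow divide_inverse)
      also have "\<dots> \<le> 2 powr (2 - real e - h k)"
        using lower[of k] by (intro powr_mono) auto
      also have "\<dots> = 4 / 2 ^ e * 2 powr (- h k)"
        by (simp add: powr_diff powr_minus powr_realpow divide_inverse)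
      finally show ?thesis .
    qed
    then have "(\<Sum>k<n. 1 / 2 ^ l k) \<le> 4 / 2 ^ e * (\<Sum>k<n. 2 powr (- h k))"
      unfolding sum_distrib_left by (intro sum_mono)
    also have "\<dots> \<le> 4 / 2 ^ e * S"
      unfolding S_def by (intro mult_left_mono sum_le_suminf summ) auto
    also have "\<dots> \<le> 1" using e by (simp add: field_simps)
    finally show ?thesis .
  qed
  moreover have "rec_total False 1 (\<lambda>X xs. l (xs ! 0))"
    unfolding l_def by (intro rec_total_add rec_total_const rec_total_running_max L(1))
  moreover have "mono l"
    unfolding l_def by (intro monoI add_right_mono Max_mono) auto
  ultimately show ?thesis using that upper by blast
qed

text \<open>Codewords are assigned to the indices \<open>n\<close>, whether or not
  \<open>\<theta> n\<close> halts, so the assignment is total recursive. The string coded by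
  \<open>\<theta> n\<close> then has the program \<open>\<rho> @ t n\<close>.\<close>

lemma prefix_free_K_partial_recursive_le:
  assumes U: "universal_prefix_free_machine U" and \<theta>: "partial_recursive \<theta>"
    and h: "computable_real_seq h" "mono h" "\<And>n. 0 \<le> h n" "summable (\<lambda>n. 2 powr (- h n))"
  obtains c where "\<And>n \<sigma>. \<theta> n = Some (str_code \<sigma>) \<Longrightarrow> real (prefix_free_K U \<sigma>) \<le> h n + real c"
proof -
  obtain l d where l: "rec_total False 1 (\<lambda>X xs. l (xs ! 0))" "mono l"
    "\<And>n. (\<Sum>k<n. 1 / 2 ^ l k) \<le> (1 :: real)" "\<And>n. real (l n) \<le> h n + real d"
    using ex_kraft_lengths[OF h] by blast
  define t where "t n = bits (l n) (kraft_num l n)" for n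
  have "rec_total False 1 (\<lambda>X xs. str_code (t (xs ! 0)))"
    unfolding t_def
    by (intro rec_total_str_code_bits rec_total_kraft_num[OF l(1)] l(1) rec_total_nth) simp
  moreover have "prefix (t m) (t n) \<Longrightarrow> m = n" for m n
    unfolding t_def by (rule prefix_bits_kraft_num[OF l(2,3)])
  ultimately obtain \<rho> where \<rho>: "\<And>n. U (\<rho> @ t n) = map_option str_decode (\<theta> n)"
    using universal_prefix_free_machine_simulates[OF U \<theta>, of t] by blast
  have "real (prefix_free_K U \<sigma>) \<le> h n + real (length \<rho> + d)" if "\<theta> n = Some (str_code \<sigma>)" for n \<sigma>
  proof -
    have "U (\<rho> @ t n) = Some \<sigma>" using \<rho> that by simp
    then have "prefix_free_K U \<sigma> \<le> length (\<rho> @ t n)" by (rule prefix_free_K_le)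
    then have "prefix_free_K U \<sigma> \<le> length \<rho> + l n" unfolding t_def by simp
    with l(4)[of n] show ?thesis by linarith
  qed
  then show ?thesis by (rule that)
qed

section \<open>The reduction\<close>

text \<open>Comparing the reals \<open>f m\<close> and \<open>h n\<close> is undecidable; comparing approximations costs
  an error of at most \<open>1\<close> in the second inequality.\<close>

lemma ex_recursive_f_inv_approx:
  assumes f: "computable_real_seq f" "\<not> bdd_above (range f)" and h: "computable_real_seq h"
  obtains g where "\<And>orc. rec_total orc 1 (\<lambda>X xs. g (xs ! 0))"
    and "\<And>n. g n \<le> f_inv f (h n)" and "\<And>n. h n - 1 \<le> f (g n)"
proof -
  obtain a b d where A: "recursive2 a" "recursive2 b" "recursive2 d"
    "\<And>n k. \<bar>f n - (real (a n k) - real (b n k)) / real (Suc (d n k))\<bar> \<le> 1 / 2 ^ k"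
    using f(1) unfolding computable_real_seq_def by blast
  obtain a' b' d' where B: "recursive2 a'" "recursive2 b'" "recursive2 d'"
    "\<And>n k. \<bar>h n - (real (a' n k) - real (b' n k)) / real (Suc (d' n k))\<bar> \<le> 1 / 2 ^ k"
    using h unfolding computable_real_seq_def by blast
  \<comment> \<open>Both approximations are within 1/4. If \<open>h n \<le> f m\<close>, then
    \<open>q n - 1 / 2 \<le> p m\<close>; this test in turn guarantees
    \<open>h n - 1 \<le> f m\<close>.\<close>
  define p where "p m = (real (a m 2) - real (b m 2)) / real (Suc (d m 2))" for m
  define q where "q n = (real (a' n 2) - real (b' n 2)) / real (Suc (d' n 2))" for n
  have p: "\<bar>f m - p m\<bar> \<le> 1 / 4" for m using A(4)[of m 2] unfolding p_def by simp
  have q: "\<bar>h n - q n\<bar> \<le> 1 / 4" for n using B(4)[of n 2] unfolding q_def by simp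
  \<comment> \<open>The test \<open>q n - 1 / 2 \<le> p m\<close> multiplied by twice both
    denominators, with the terms sorted so that all are natural numbers.\<close>
  define F where "F m n = 2 * a' n 2 * Suc (d m 2) + 2 * b m 2 * Suc (d' n 2) -
    (2 * a m 2 * Suc (d' n 2) + 2 * b' n 2 * Suc (d m 2) + Suc (d m 2) * Suc (d' n 2))" for m n
  define g where "g n = (LEAST m. F m n = 0)" for n
  have F: "F m n = 0 \<longleftrightarrow> q n - 1 / 2 \<le> p m" for m n
  proof -
    define D where "D = real (Suc (d m 2))"
    define E where "E = real (Suc (d' n 2))"
    have pos: "D > 0" "E > 0" unfolding D_def E_def by auto
    have "F m n = 0 \<longleftrightarrow> 2 * a' n 2 * Suc (d m 2) + 2 * b m 2 * Suc (d' n 2) \<le>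
      2 * a m 2 * Suc (d' n 2) + 2 * b' n 2 * Suc (d m 2) + Suc (d m 2) * Suc (d' n 2)"
      unfolding F_def by simp
    also have "\<dots> \<longleftrightarrow> 2 * real (a' n 2) * D + 2 * real (b m 2) * E \<le>
      2 * real (a m 2) * E + 2 * real (b' n 2) * D + D * E"
      unfolding D_def E_def by (simp only: of_nat_le_iff of_nat_add of_nat_mult of_nat_numeral
        flip: of_nat_le_iff[where 'a = real])
    also have "\<dots> \<longleftrightarrow> (real (a' n 2) - real (b' n 2)) / E - 1 / 2
        \<le> (real (a m 2) - real (b m 2)) / D"
      using pos by (simp add: field_simps)
    finally show ?thesis unfolding D_def E_def p_def q_def .
  qed
  have above: "F m n = 0" if "h n \<le> f m" for m n
    unfolding F using that p[of m] q[of n] by linarith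
  have below: "h n - 1 \<le> f m" if "F m n = 0" for m n
    using that p[of m] q[of n] unfolding F by linarith
  have ex: "\<exists>m. h n \<le> f m" for n
    using f(2) by (meson bdd_above.I2 linear)
  have "rec_total orc 1 (\<lambda>X xs. g (xs ! 0))" for orc
    unfolding g_def
  proof (rule rec_total_Least)
    show "rec_total orc (Suc 1) (\<lambda>X ys. F (ys ! 0) (tl ys ! 0))"
      unfolding F_def
      by (intro rec_total_intros A(1-3)[THEN rec_total_recursive2]
          B(1-3)[THEN rec_total_recursive2]) auto
    show "\<exists>m. F m (xs ! 0) = 0" for xs using ex above by blast
  qed
  moreover have "g n \<le> f_inv f (h n)" for n
    unfolding g_def f_inv_def using ex by (intro Least_le above) (rule LeastI_ex)
  moreover have "h n - 1 \<le> f (g n)" for n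
    unfolding g_def using ex above by (intro below) (rule LeastI_ex, blast)
  ultimately show ?thesis using that by blast
qed

text \<open>This makes the code computable from the oracle: position \<open>i\<close> has weight
  \<open>2 ^ i\<close>, and for binary \<open>X\<close> its digit is
  \<open>Suc (X i)\<close>.\<close>

lemma str_code_initial_segment:
  assumes "\<And>i. X i \<in> {0, 1}"
  shows "str_code (initial_segment X n) = rec_nat 0 (\<lambda>i r. r + 2 ^ i * Suc (X i)) n"
proof (induction n)
  case (Suc n)
  have "initial_segment X (Suc n) = initial_segment X n @ [X n = 1]"
    unfolding initial_segment_def by simp
  moreover have "length (initial_segment X n) = n" unfolding initial_segment_def by simp
  ultimately show ?case using Suc assms[of n] by (auto simp: str_code_append)
qed (simp add: initial_segment_def)

lemma partial_recursive_functional_total: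
  assumes "rec_total True 1 (\<lambda>X xs. G X (xs ! 0))"
  shows "partial_recursive_functional (\<lambda>X. Some (G X))"
proof -
  obtain e where e: "\<And>X xs. length xs = 1 \<Longrightarrow> rec_eval X e xs (G X (xs ! 0))"
    using assms by (rule rec_totalE) blast
  have "rec_eval X e [n] (G X n)" for X n using e[of "[n]" X] by simp
  then have "Some (G X) = Some Y \<longleftrightarrow> (\<forall>n. rec_eval X e [n] (Y n))" for X Y
    by (metis ext option.inject rec_eval_functional)
  then show ?thesis unfolding partial_recursive_functional_def by blast
qed

theorem mainTheorem11:
  fixes U :: "bool list \<rightharpoonup> bool list"
    and f h h' :: "nat \<Rightarrow> real"
  assumes "universal_prefix_free_machine U"
    and "\<And>n. 0 \<le> f n" and "order_function f" and "sub_identical f"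
    and "\<And>n. 0 \<le> h n" and "order_function h"
    and "\<And>n. 0 \<le> h' n" and "order_function h'"
    and "summable (\<lambda>n. 2 powr (- h n))"
    and "summable (\<lambda>n. 2 powr (- h' n))"
    and "filterlim (\<lambda>n. h n - h' n) at_top sequentially"
  shows "LUA (\<lambda>n. 2 powr (real (f_inv f (h n)) + 1)) \<le>\<^sub>s COMPLEX U f"
proof -
  note U = assms(1)
  have f: "computable_real_seq f" "\<not> bdd_above (range f)" and h: "computable_real_seq h"
    and h': "computable_real_seq h'" "mono h'"
    using assms(3,6,8) unfolding order_function_def by auto
  obtain g where g: "\<And>orc. rec_total orc 1 (\<lambda>X xs. g (xs ! 0))"
    "\<And>n. g n \<le> f_inv f (h n)" "\<And>n. h n - 1 \<le> f (g n)"
    using ex_recursive_f_inv_approx[OF f h] by blast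
  obtain \<phi> where \<phi>: "partial_recursive \<phi>"
    "\<And>\<theta>. partial_recursive \<theta> \<Longrightarrow> \<exists>a b. 0 < a \<and> (\<forall>x. \<phi> (a * x + b) = \<theta> x)"
    using ex_linearly_universal_pos[OF U] by blast
  obtain c where c: "\<And>n \<sigma>. \<phi> n = Some (str_code \<sigma>) \<Longrightarrow> real (prefix_free_K U \<sigma>) \<le> h' n + real c"
    using prefix_free_K_partial_recursive_le[OF U \<phi>(1) h' assms(7,10)] by blast
  \<comment> \<open>The recursion is total for every oracle, and for binary \<open>X\<close> its
    value is the code of an initial segment.\<close>
  define G where "G X n = rec_nat 0 (\<lambda>i r. r + 2 ^ i * Suc (X i)) (g n)"
    for X :: "nat \<Rightarrow> nat" and n
  have "rec_total True 1 (\<lambda>X xs. G X (xs ! 0))"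
    unfolding G_def
    by (intro rec_total_rec_nat rec_total_intros rec_total_oracle g(1)) auto
  then have "partial_recursive_functional (\<lambda>X. Some (G X))"
    by (rule partial_recursive_functional_total)
  moreover have "G X \<in> LUA (\<lambda>n. 2 powr (real (f_inv f (h n)) + 1))" if X_COMPLEX: "X \<in> COMPLEX U f" for X
  proof -
    have X: "X n \<in> {0, 1}" for n using X_COMPLEX unfolding COMPLEX_def by blast
    obtain e :: nat where e: "\<And>n. real (prefix_free_K U (initial_segment X n)) \<ge> f n - real e"
      using X_COMPLEX unfolding COMPLEX_def by blast
    have G: "G X n = str_code (initial_segment X (g n))" for n
      unfolding G_def using str_code_initial_segment[OF X] by simp
    have bound: "real (G X n) < 2 powr (real (f_inv f (h n)) + 1)" for n
    proof -
      have "length (initial_segment X (g n)) = g n" unfolding initial_segment_def by simp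
      then have "G X n < 2 ^ Suc (g n)"
        using str_code_bounds(2)[of "initial_segment X (g n)"] unfolding G by simp
      also have "\<dots> \<le> 2 ^ Suc (f_inv f (h n))"
        using g(2)[of n] by (intro power_increasing) auto
      finally have "real (G X n) < real (2 ^ Suc (f_inv f (h n)))" by (simp only: of_nat_less_iff)
      also have "\<dots> = 2 powr (real (f_inv f (h n)) + 1)"
        by (simp add: powr_add powr_realpow)
      finally show ?thesis .
    qed
    \<comment> \<open>The constant \<open>e\<close> comes from the complexity of \<open>X\<close>,
      \<open>c\<close> from the Kraft--Chaitin bound, and 1 from the approximation of
      \<open>f_inv\<close>.\<close>
    have "eventually (\<lambda>n. real e + real c + 1 < h n - h' n) sequentially"
      using assms(11) by (simp add: filterlim_at_top_dense)
    then obtain N where N: "\<And>n. N \<le> n \<Longrightarrow> real e + real c + 1 < h n - h' n"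
      by (auto simp: eventually_sequentially)
    have avoid: "\<phi> n \<noteq> Some (G X n)" if "N \<le> n" for n
    proof
      assume "\<phi> n = Some (G X n)"
      then have "real (prefix_free_K U (initial_segment X (g n))) \<le> h' n + real c"
        unfolding G by (rule c)
      with e[of "g n"] g(3)[of n] N[OF that] show False by linarith
    qed
    \<comment> \<open>\<open>N\<close> depends on \<open>X\<close>, but only the linearly universal
      witness changes with it; the functional \<open>G\<close> does not.\<close>
    have "linearly_universal (\<lambda>n. if N \<le> n then \<phi> n else None)"
      using \<phi> by (rule linearly_universal_restrict_atLeast)
    moreover have "\<not> (\<exists>n\<in>dom (\<lambda>n. if N \<le> n then \<phi> n else None).
        (if N \<le> n then \<phi> n else None) = Some (G X n))"
      using avoid by auto
    ultimately show ?thesis unfolding LUA_def using bound by blast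
  qed
  ultimately show ?thesis
    unfolding strongly_reducible_def by (intro exI[of _ "\<lambda>X. Some (G X)"]) auto
qed

end
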